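(* Let $d \geq 2$ and let $\mu$ be a Borel probability measure on $\mathbb{T}^d$. If the observability inequality holds for $\mu$, then the upper Minkowski dimension of the support of $\mu$ is $\geq d-2$.
   Context: $\mathbb{T}^d=\mathbb{R}^d/\mathbb{Z}^d$ with Lebesgue measure $dx$. $\sqrt{\mathbb{N}}=\{\sqrt n : n\in\mathbb{N}\}$. For $\lambda\in\sqrt{\mathbb{N}}$, $\mathcal{S}^{d-1}_\lambda=\{k\in\mathbb{Z}^d : |k|=\lambda\}$ and $E_\lambda=\{\sum_{k\in\mathcal{S}^{d-1}_\lambda} \widehat{u}_k e^{2\pi i k\cdot x} : \widehat{u}_k\in\mathbb{C}\}$ (the Laplace eigenspace with eigenvalue $-4\pi^2\lambda^2$). The observability inequality holds for $\mu$ if there is a finite constant $\mathfrak{c}$ such that $\int_{\mathbb{T}^d}|u|^2\,dx\le \mathfrak{c}\int_{\mathbb{T}^d}|u|^2\,d\mu$ for all $u\in\bigcup_{\lambda\in\sqrt{\mathbb{N}}}E_\lambda$. For $E\subset\mathbb{T}^d$, let $N_\delta(E)$ be the minimal number of closed balls of radius $\delta>0$ needed to cover $E$; the upper Minkowski dimension of $E$ is $\overline{\dim}_{\mathrm M}(E)=\limsup_{\delta\to0}\frac{\log N_\delta(E)}{-\log\delta}$. *)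

theory Defs
  imports "HOL-Probability.Probability"
begin

definition ivec :: "int ^ 'n \<Rightarrow> real ^ 'n::finite" where
  "ivec k = (\<chi> i. real_of_int (k $ i))"

lemma ivec_nth [simp]: "ivec k $ i = real_of_int (k $ i)"
  by (simp add: ivec_def)

lemma ivec_0 [simp]: "ivec 0 = 0"
  and ivec_add: "ivec (k + l) = ivec k + ivec l"
  and ivec_minus: "ivec (- k) = - ivec k"
  and ivec_diff: "ivec (k - l) = ivec k - ivec l"
  by (simp_all add: vec_eq_iff)

definition torus_rel :: "real ^ 'n::finite \<Rightarrow> real ^ 'n \<Rightarrow> bool" where
  "torus_rel x y \<longleftrightarrow> (\<exists>k. x - y = ivec k)"

lemma equivp_torus_rel: "equivp (torus_rel :: real ^ 'n::finite \<Rightarrow> _)"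
proof (rule equivpI)
  show "reflp (torus_rel :: real ^ 'n \<Rightarrow> _)"
    by (auto simp: reflp_def torus_rel_def intro!: exI[of _ 0])
  show "symp (torus_rel :: real ^ 'n \<Rightarrow> _)"
  proof (rule sympI)
    fix x y :: "real ^ 'n" assume "torus_rel x y"
    then obtain k where "x - y = ivec k" by (auto simp: torus_rel_def)
    then have "y - x = ivec (- k)" by (simp add: ivec_minus flip: \<open>x - y = ivec k\<close>)
    then show "torus_rel y x" by (auto simp: torus_rel_def)
  qed
  show "transp (torus_rel :: real ^ 'n \<Rightarrow> _)"
  proof (rule transpI)
    fix x y z :: "real ^ 'n" assume "torus_rel x y" "torus_rel y z"
    then obtain k l where "x - y = ivec k" "y - z = ivec l" by (auto simp: torus_rel_def)
    then have "x - z = ivec (k + l)" by (simp add: ivec_add flip: \<open>x - y = ivec k\<close> \<open>y - z = ivec l\<close>)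
    then show "torus_rel x z" by (auto simp: torus_rel_def)
  qed
qed

quotient_type (overloaded) 'n torus = "real ^ 'n::finite" / torus_rel
  morphisms rep_torus to_torus
  by (rule equivp_torus_rel)

lemma to_torus_eq_iff: "to_torus x = to_torus y \<longleftrightarrow> (\<exists>k. x - y = ivec k)"
  by (simp add: torus.abs_eq_iff torus_rel_def)

lemma torus_cases: obtains y where "x = to_torus y"
  by (metis Quotient3_abs_rep Quotient3_torus)

lift_definition torus_dist :: "'n::finite torus \<Rightarrow> 'n torus \<Rightarrow> real" is
  "\<lambda>x y. INF k. norm (x - y + ivec k)"
proof -
  fix x x' y y' :: "real ^ 'n"
  assume "torus_rel x x'" "torus_rel y y'"
  then obtain k l where k: "x - x' = ivec k" and l: "y - y' = ivec l"
    by (auto simp: torus_rel_def)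
  have "range (\<lambda>m. norm (x - y + ivec m)) = range (\<lambda>m. norm (x' - y' + ivec (m + (k - l))))"
  proof -
    have "x - y + ivec m = x' - y' + ivec (m + (k - l))" for m
      by (simp add: ivec_add ivec_diff algebra_simps flip: k l)
    then show ?thesis by simp
  qed
  also have "\<dots> = (\<lambda>m. norm (x' - y' + ivec m)) ` range (\<lambda>m. m + (k - l))"
    by (simp only: image_image)
  also have "range (\<lambda>m. m + (k - l)) = UNIV"
    by (rule surjI[of _ "\<lambda>m. m - (k - l)"]) simp
  finally show "(INF m. norm (x - y + ivec m)) = (INF m. norm (x' - y' + ivec m))"
    by simp
qed

lemma torus_dist_le: "torus_dist (to_torus x) (to_torus y) \<le> norm (x - y + ivec k)"
  unfolding torus_dist.abs_eq by (rule cINF_lower) (auto intro!: bdd_belowI[of _ 0])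

lemma torus_dist_less_iff:
  "torus_dist (to_torus x) (to_torus y) < e \<longleftrightarrow> (\<exists>k. norm (x - y + ivec k) < e)"
  unfolding torus_dist.abs_eq by (subst cINF_less_iff) (auto intro!: bdd_belowI[of _ 0])

lemma torus_dist_nonneg: "0 \<le> torus_dist x y"
  by (rule torus_cases[of x], rule torus_cases[of y])
     (auto simp: torus_dist.abs_eq intro!: cINF_greatest)

lemma torus_dist_eq_0_iff: "torus_dist x y = 0 \<longleftrightarrow> x = y"
proof -
  obtain v w where v: "x = to_torus v" and w: "y = to_torus w"
    by (metis torus_cases)
  have "x = y" if d: "torus_dist x y = 0"
  proof (rule ccontr)
    assume "x \<noteq> y"
    then have nz: "v - w + ivec k \<noteq> 0" for k
    proof -
      have "v - w \<noteq> ivec (- k)" using \<open>x \<noteq> y\<close> unfolding v w to_torus_eq_iff by blast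
      then show ?thesis by (simp add: ivec_minus eq_neg_iff_add_eq_0)
    qed
    have ex: "\<exists>k. norm (v - w + ivec k) < e" if "e > 0" for e
      using that d unfolding v w by (subst torus_dist_less_iff[symmetric]) simp
    obtain k where k: "norm (v - w + ivec k) < 1/2" using ex[of "1/2"] by auto
    obtain l where l: "norm (v - w + ivec l) < min (1/2) (norm (v - w + ivec k))"
      using ex[of "min (1/2) (norm (v - w + ivec k))"] nz[of k] by auto
    have "norm (ivec (k - l)) = norm ((v - w + ivec k) - (v - w + ivec l))"
      by (simp add: ivec_diff)
    also have "\<dots> < 1" using norm_triangle_ineq4[of "v - w + ivec k" "v - w + ivec l"] k l by linarith
    finally have lt: "norm (ivec (k - l)) < 1" .
    have "(k - l) $ i = 0" for i
    proof -
      have "\<bar>ivec (k - l) $ i\<bar> < 1" using component_le_norm_cart[of "ivec (k - l)" i] lt by linarith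
      then show ?thesis by simp
    qed
    then have "k = l" by (simp add: vec_eq_iff)
    with l show False by simp
  qed
  moreover have "torus_dist x x = 0"
    using torus_dist_le[of v v 0] torus_dist_nonneg[of x x] by (simp add: v)
  ultimately show ?thesis by auto
qed

lemma torus_dist_triangle: "torus_dist x y \<le> torus_dist x z + torus_dist y z"
proof (rule field_le_epsilon)
  fix e :: real assume e: "e > 0"
  obtain u v w where u: "x = to_torus u" and v: "y = to_torus v" and w: "z = to_torus w"
    by (metis torus_cases)
  obtain k where k: "norm (u - w + ivec k) < torus_dist x z + e/2"
    using e torus_dist_less_iff[of u w "torus_dist x z + e/2"] by (auto simp: u w)
  obtain l where l: "norm (v - w + ivec l) < torus_dist y z + e/2"
    using e torus_dist_less_iff[of v w "torus_dist y z + e/2"] by (auto simp: v w)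
  have "torus_dist x y \<le> norm (u - v + ivec (k - l))"
    unfolding u v by (rule torus_dist_le)
  also have "u - v + ivec (k - l) = (u - w + ivec k) - (v - w + ivec l)"
    by (simp add: ivec_diff)
  also have "norm \<dots> \<le> norm (u - w + ivec k) + norm (v - w + ivec l)"
    by (rule norm_triangle_ineq4)
  finally show "torus_dist x y \<le> torus_dist x z + torus_dist y z + e" using k l by linarith
qed

lemma open_vimage_to_torus_iff:
  "open (to_torus -` U) \<longleftrightarrow> (\<forall>x\<in>U. \<exists>e>0. \<forall>y. torus_dist y x < e \<longrightarrow> y \<in> U)"
  (is "?L \<longleftrightarrow> ?R")
proof
  assume L: ?L
  show ?R
  proof
    fix x assume x: "x \<in> U"
    obtain v where v: "x = to_torus v" by (metis torus_cases)
    with x have "v \<in> to_torus -` U" by simp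
    with L obtain e where e: "e > 0" "ball v e \<subseteq> to_torus -` U"
      by (rule openE)
    have "y \<in> U" if y: "torus_dist y x < e" for y
    proof -
      obtain w where w: "y = to_torus w" by (metis torus_cases)
      obtain k where k: "norm (w - v + ivec k) < e"
        using y by (auto simp: v w torus_dist_less_iff)
      have "w + ivec k \<in> ball v e" using k by (simp add: dist_norm norm_minus_commute algebra_simps)
      then have "to_torus (w + ivec k) \<in> U" using e by auto
      moreover have "to_torus (w + ivec k) = y"
        unfolding w to_torus_eq_iff by (auto intro!: exI[of _ k])
      ultimately show ?thesis by simp
    qed
    then show "\<exists>e>0. \<forall>y. torus_dist y x < e \<longrightarrow> y \<in> U" using e by auto
  qed
next
  assume R: ?R
  show ?L
    unfolding open_dist
  proof
    fix v assume "v \<in> to_torus -` U"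
    then obtain e where e: "e > 0" "\<And>y. torus_dist y (to_torus v) < e \<Longrightarrow> y \<in> U" using R by auto
    have "w \<in> to_torus -` U" if "dist w v < e" for w
      using that e(2)[of "to_torus w"] torus_dist_le[of w v 0] by (simp add: dist_norm)
    then show "\<exists>e>0. \<forall>w. dist w v < e \<longrightarrow> w \<in> to_torus -` U" using e by auto
  qed
qed

text \<open>The topology is the quotient topology; the instance proof checks that it is induced by
  the quotient metric.\<close>

instantiation torus :: (finite) metric_space
begin

definition dist_torus :: "'a torus \<Rightarrow> 'a torus \<Rightarrow> real" where
  "dist_torus = torus_dist"

definition uniformity_torus :: "('a torus \<times> 'a torus) filter" where
  "uniformity_torus = (INF e\<in>{0 <..}. principal {(x, y). dist x y < e})"

definition open_torus :: "'a torus set \<Rightarrow> bool" where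
  "open_torus U \<longleftrightarrow> open (to_torus -` U)"

instance
proof
  show "uniformity = (INF e\<in>{0 <..}. principal {(x, y :: 'a torus). dist x y < e})"
    by (rule uniformity_torus_def)
next
  fix U :: "'a torus set"
  have sym: "torus_dist x y = torus_dist y x" for x y :: "'a torus"
    using torus_dist_triangle[of x y x] torus_dist_triangle[of y x y] torus_dist_eq_0_iff[of x x]
      torus_dist_eq_0_iff[of y y] by (simp add: antisym)
  have eventually_unif:
    "eventually P uniformity \<longleftrightarrow> (\<exists>e>0. \<forall>x y. torus_dist x y < e \<longrightarrow> P (x, y))"
    for P :: "'a torus \<times> 'a torus \<Rightarrow> bool"
    unfolding uniformity_torus_def dist_torus_def
    by (subst eventually_INF_base)
       (auto simp: eventually_principal subset_eq intro: bexI[of _ "min _ _"])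
  show "open U \<longleftrightarrow> (\<forall>x\<in>U. eventually (\<lambda>(x', y). x' = x \<longrightarrow> y \<in> U) uniformity)"
    unfolding open_torus_def open_vimage_to_torus_iff eventually_unif
    by (simp add: sym)
next
  fix x y z :: "'a torus"
  show "dist x y = 0 \<longleftrightarrow> x = y" by (simp add: dist_torus_def torus_dist_eq_0_iff)
  show "dist x y \<le> dist x z + dist y z" by (simp add: dist_torus_def torus_dist_triangle)
qed

end

lemma continuous_on_to_torus: "continuous_on S to_torus"
  by (rule continuous_on_subset[of UNIV])
     (auto simp: continuous_on_open_vimage open_torus_def)

lemma compact_UNIV_torus: "compact (UNIV :: 'n::finite torus set)"
proof -
  have "x \<in> to_torus ` cbox (0::real^'n) 1" for x :: "'n torus"
  proof -
    obtain v where v: "x = to_torus v" by (metis torus_cases)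
    define w :: "real^'n" where "w = (\<chi> i. frac (v $ i))"
    have "v - w = ivec (\<chi> i. \<lfloor>v $ i\<rfloor>)" by (simp add: vec_eq_iff w_def frac_def)
    then have "x = to_torus w" unfolding v to_torus_eq_iff by blast
    moreover have "w \<in> cbox 0 1" by (simp add: mem_box_cart w_def frac_lt_1 less_imp_le)
    ultimately show ?thesis by blast
  qed
  then have "UNIV = to_torus ` cbox (0::real^'n) 1" by blast
  then show ?thesis by (metis compact_cbox compact_continuous_image continuous_on_to_torus)
qed

definition torus_lebesgue :: "'n::finite torus measure" where
  "torus_lebesgue =
     distr (restrict_space lborel {x :: real ^ 'n. \<forall>i. 0 \<le> x $ i \<and> x $ i < 1}) borel to_torus"

lift_definition torus_char :: "int ^ 'n \<Rightarrow> 'n::finite torus \<Rightarrow> complex" is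
  "\<lambda>k x. exp (2 * complex_of_real pi * \<i> * complex_of_real (ivec k \<bullet> x))"
proof -
  fix k :: "int ^ 'n" and x y :: "real ^ 'n"
  assume "torus_rel x y"
  then obtain l where l: "x - y = ivec l" by (auto simp: torus_rel_def)
  have "ivec k \<bullet> x = ivec k \<bullet> y + of_int (\<Sum>i\<in>UNIV. k $ i * l $ i)"
  proof -
    have "ivec k \<bullet> x - ivec k \<bullet> y = ivec k \<bullet> ivec l" by (simp add: inner_diff_right flip: l)
    also have "\<dots> = of_int (\<Sum>i\<in>UNIV. k $ i * l $ i)" by (simp add: inner_vec_def)
    finally show ?thesis by simp
  qed
  then show "exp (2 * complex_of_real pi * \<i> * complex_of_real (ivec k \<bullet> x)) =
      exp (2 * complex_of_real pi * \<i> * complex_of_real (ivec k \<bullet> y))"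
    unfolding exp_eq by (intro exI[of _ "\<Sum>i\<in>UNIV. k $ i * l $ i"]) (simp add: algebra_simps)
qed

definition lattice_sphere :: "real \<Rightarrow> (int ^ 'n::finite) set" where
  "lattice_sphere r = {k. norm (ivec k) = r}"

lemma finite_lattice_sphere: "finite (lattice_sphere r :: (int ^ 'n::finite) set)"
proof (rule finite_subset)
  show "(lattice_sphere r :: (int ^ 'n) set) \<subseteq> vec_lambda ` (UNIV \<rightarrow>\<^sub>E {- \<lceil>r\<rceil>..\<lceil>r\<rceil>})"
  proof
    fix k :: "int ^ 'n" assume "k \<in> lattice_sphere r"
    then have "\<bar>real_of_int (k $ i)\<bar> \<le> r" for i
      using component_le_norm_cart[of "ivec k" i] by (simp add: lattice_sphere_def)
    then have "\<bar>k $ i\<bar> \<le> \<lceil>r\<rceil>" for i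
      using le_of_int_ceiling[of r] by (metis of_int_abs of_int_le_iff order_trans)
    then have "vec_nth k \<in> UNIV \<rightarrow>\<^sub>E {- \<lceil>r\<rceil>..\<lceil>r\<rceil>}" by (auto simp: abs_le_iff minus_le_iff)
    then show "k \<in> vec_lambda ` (UNIV \<rightarrow>\<^sub>E {- \<lceil>r\<rceil>..\<lceil>r\<rceil>})"
      by (metis imageI vec_nth_inverse)
  qed
  show "finite (vec_lambda ` (UNIV \<rightarrow>\<^sub>E {- \<lceil>r\<rceil>..\<lceil>r\<rceil>}) :: (int ^ 'n) set)"
    by (rule finite_imageI, rule finite_PiE) simp_all
qed

definition laplace_eigenspace :: "real \<Rightarrow> ('n::finite torus \<Rightarrow> complex) set" where
  "laplace_eigenspace r = {(\<lambda>x. \<Sum>k\<in>lattice_sphere r. c k * torus_char k x) | c. True}"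

definition observability :: "'n::finite torus measure \<Rightarrow> bool" where
  "observability \<mu> \<longleftrightarrow>
     (\<exists>C::real. \<forall>u \<in> (\<Union>m::nat. laplace_eigenspace (sqrt (real m))).
        (LINT x|torus_lebesgue. (cmod (u x))\<^sup>2) \<le> C * (LINT x|\<mu>. (cmod (u x))\<^sup>2))"

definition measure_support :: "'a::topological_space measure \<Rightarrow> 'a set" where
  "measure_support \<mu> = {x. \<forall>U. open U \<and> x \<in> U \<longrightarrow> emeasure \<mu> U > 0}"

definition covering_number :: "real \<Rightarrow> 'n::finite torus set \<Rightarrow> nat" where
  "covering_number \<delta> E = (LEAST m. \<exists>A. finite A \<and> card A = m \<and> E \<subseteq> (\<Union>a\<in>A. cball a \<delta>))"

text \<open>By compactness the minimum defining the covering number is over a nonempty set.\<close>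

lemma covering_number_attained:
  fixes E :: "'n::finite torus set"
  assumes "\<delta> > 0"
  shows "\<exists>A. finite A \<and> card A = covering_number \<delta> E \<and> E \<subseteq> (\<Union>a\<in>A. cball a \<delta>)"
proof -
  obtain A :: "'n torus set" where A: "finite A" "UNIV \<subseteq> (\<Union>a\<in>A. ball a \<delta>)"
    using compact_imp_seq_compact[OF compact_UNIV_torus] assms
      seq_compact_imp_totally_bounded by metis
  have "E \<subseteq> UNIV" by (rule subset_UNIV)
  also note A(2)
  also have "(\<Union>a\<in>A. ball a \<delta>) \<subseteq> (\<Union>a\<in>A. cball a \<delta>)"
    by (intro UN_mono subset_refl ball_subset_cball)
  finally have "\<exists>m A. finite A \<and> card A = m \<and> E \<subseteq> (\<Union>a\<in>A. cball a \<delta>)"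
    using A(1) by blast
  then show ?thesis unfolding covering_number_def by (rule LeastI_ex)
qed

text \<open>Isabelle's \<^term>\<open>ln 0 = (0::real)\<close> matters here only for the empty set,
  whose dimension thereby becomes \<open>0\<close>.\<close>

definition upper_minkowski_dim :: "'n::finite torus set \<Rightarrow> ereal" where
  "upper_minkowski_dim E =
     Limsup (at_right 0) (\<lambda>\<delta>. ereal (ln (real (covering_number \<delta> E)) / (- ln \<delta>)))"

end

theory Submission
  imports Defs "HOL-Real_Asymp.Real_Asymp"
begin

text \<open>
  Let \<open>E\<close> be the support of \<open>\<mu>\<close> and let \<open>N\<close> be the number of lattice points on the sphere of
  radius \<open>\<lambda>\<close>, which is the dimension of the eigenspace \<open>E\<^sub>\<lambda>\<close>. The proof compares \<open>N\<close> with
  the number \<open>M\<close> of balls of radius \<open>\<delta> = \<epsilon> / \<lambda>\<close> that cover \<open>E\<close>, where \<open>\<epsilon>\<close> is small but fixed.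

  Vanishing at the \<open>M\<close> centres is a system of \<open>M\<close> linear equations on \<open>E\<^sub>\<lambda>\<close>, so there are
  \<open>N - M\<close> orthonormal eigenfunctions \<open>u\<^sub>i\<close> that vanish at all centres. Since the characters of
  frequency \<open>\<lambda>\<close> are Lipschitz with constant \<open>2\<pi>\<lambda>\<close>, Bessel's inequality gives
  \<open>\<Sum>\<^sub>i |u\<^sub>i(x)|\<^sup>2 = \<Sum>\<^sub>i |u\<^sub>i(x) - u\<^sub>i(a)|\<^sup>2 \<le> N (2\<pi>\<lambda>\<delta>)\<^sup>2\<close> at every point \<open>x\<close> within \<open>\<delta>\<close> of a
  centre \<open>a\<close>, hence \<open>\<mu>\<close>-almost everywhere. It is essential to bound the sum over \<open>i\<close>: the same
  argument for a single \<open>u\<^sub>i\<close> has the same right-hand side and gains nothing. Summing the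
  observability inequality over \<open>i\<close>, with Parseval on the left, now yields \<open>N - M \<le> C N (2\<pi>\<epsilon>)\<^sup>2 \<le> N / 2\<close>, that is,
  \<open>N \<le> 2 M\<close> (lemma \<open>observability_sphere_card_le\<close>).

  On the other hand, the \<open>R\<^sup>d\<close> points of the cube \<open>{1..R}\<^sup>d\<close> lie on at most \<open>d R\<^sup>2\<close> spheres about
  the origin, so some sphere of radius \<open>\<lambda> \<le> R \<surd>d\<close> carries at least \<open>R\<^sup>d\<^sup>-\<^sup>2 / d\<close> of them (lemma
  \<open>exists_rich_lattice_sphere\<close>). Therefore coverings of \<open>E\<close> by balls of radius comparable to
  \<open>1 / R\<close> need at least a constant times \<open>R\<^sup>d\<^sup>-\<^sup>2\<close> balls, for every \<open>R\<close>, which is incompatible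
  with an upper Minkowski dimension below \<open>d - 2\<close>.
\<close>

section \<open>Orthonormal systems in the kernel of finitely many functionals\<close>

text \<open>
  Gaussian elimination: an equation with a nonzero coefficient at \<open>p\<close> is used to remove the
  unknown \<open>p\<close> from all the others.
\<close>

lemma homogeneous_system_nontrivial_solution:
  fixes f :: "'i \<Rightarrow> 'k \<Rightarrow> 'a::field"
  assumes "finite I" "finite K" "card I < card K"
  shows "\<exists>c. (\<exists>k\<in>K. c k \<noteq> 0) \<and> (\<forall>i\<in>I. (\<Sum>k\<in>K. c k * f i k) = 0)"
  using assms
proof (induction I arbitrary: f K rule: finite_induct)
  case empty
  then obtain k where "k \<in> K" by fastforce
  then show ?case by (intro exI[of _ "\<lambda>_. 1"]) auto
next
  case (insert i I)
  show ?case
  proof (cases "\<forall>k\<in>K. f i k = 0")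
    case True
    with insert.IH[of K f] insert.prems insert.hyps show ?thesis by auto
  next
    case False
    then obtain p where p: "p \<in> K" "f i p \<noteq> 0" by auto
    define g where "g = (\<lambda>j k. f j k - f j p / f i p * f i k)"
    have "card I < card (K - {p})"
      using insert.prems insert.hyps p by simp
    with insert.IH[of "K - {p}" g] insert.prems obtain c
      where c: "\<exists>k\<in>K - {p}. c k \<noteq> 0" "\<And>j. j \<in> I \<Longrightarrow> (\<Sum>k\<in>K - {p}. c k * g j k) = 0"
      by auto
    define S where "S = (\<Sum>k\<in>K - {p}. c k * f i k)"
    define c' where "c' = c(p := - S / f i p)"
    have split: "(\<Sum>k\<in>K. c' k * h k) = - S / f i p * h p + (\<Sum>k\<in>K - {p}. c k * h k)" for h
    proof -
      have "(\<Sum>k\<in>K. c' k * h k) = c' p * h p + (\<Sum>k\<in>K - {p}. c' k * h k)"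
        by (rule sum.remove[OF \<open>finite K\<close> p(1)])
      then show ?thesis by (simp add: c'_def)
    qed
    have "(\<Sum>k\<in>K. c' k * f j k) = 0" if "j \<in> I" for j
    proof -
      have "0 = (\<Sum>k\<in>K - {p}. c k * f j k) - f j p / f i p * S"
        using c(2)[OF that]
        by (simp add: g_def S_def sum_distrib_left sum_subtractf algebra_simps)
      then show ?thesis by (simp add: split)
    qed
    moreover have "(\<Sum>k\<in>K. c' k * f i k) = 0"
      using p by (simp add: split flip: S_def)
    moreover have "\<exists>k\<in>K. c' k \<noteq> 0"
      using c(1) by (auto simp: c'_def)
    ultimately show ?thesis by (intro exI[of _ c']) auto
  qed
qed

text \<open>
  Orthogonality to the vectors already found is a further
  system of linear equations, so as long as the total number of equations is below the dimension
  there is another nonzero solution, which is then normalised.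
\<close>

lemma orthonormal_system_in_kernel:
  fixes F :: "('k \<Rightarrow> complex) set"
  assumes "finite K" "finite F" "n + card F \<le> card K"
  shows "\<exists>c :: nat \<Rightarrow> 'k \<Rightarrow> complex.
    (\<forall>i<n. \<forall>f\<in>F. (\<Sum>k\<in>K. c i k * f k) = 0) \<and>
    (\<forall>i<n. \<forall>j<n. (\<Sum>k\<in>K. c i k * cnj (c j k)) = (if i = j then 1 else 0))"
  using assms(3)
proof (induction n)
  case 0
  then show ?case by simp
next
  case (Suc n)
  then have "n + card F \<le> card K" by simp
  then obtain c where
    c: "\<forall>i<n. \<forall>f\<in>F. (\<Sum>k\<in>K. c i k * f k) = 0"
       "\<forall>i<n. \<forall>j<n. (\<Sum>k\<in>K. c i k * cnj (c j k)) = (if i = j then 1 else 0)"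
    using Suc.IH by blast
  have ker: "(\<Sum>k\<in>K. c i k * f k) = 0" if "i < n" "f \<in> F" for i f
    using c(1) that by blast
  have orth: "(\<Sum>k\<in>K. c i k * cnj (c j k)) = (if i = j then 1 else 0)" if "i < n" "j < n" for i j
    using c(2) that by blast
  define G where "G = F \<union> (\<lambda>i k. cnj (c i k)) ` {..<n}"
  have "card G \<le> card F + n"
    unfolding G_def
    by (rule order_trans[OF card_Un_le]) (use card_image_le[of "{..<n}"] in auto)
  then have "card G < card K" using Suc.prems by simp
  moreover have "finite G" using assms(2) by (simp add: G_def)
  ultimately obtain b where b0: "\<exists>k\<in>K. b k \<noteq> 0" and b: "\<forall>g\<in>G. (\<Sum>k\<in>K. b k * g k) = 0"
    using homogeneous_system_nontrivial_solution[of G K "\<lambda>g. g"] assms(1) by blast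
  have bG: "(\<Sum>k\<in>K. b k * g k) = 0" if "g \<in> G" for g
    using b that by blast
  define s where "s = (\<Sum>k\<in>K. (cmod (b k))\<^sup>2)"
  have s: "s > 0"
    unfolding s_def using b0 assms(1) by (auto intro!: sum_pos2)
  define v where "v = (\<lambda>k. b k / complex_of_real (sqrt s))"
  have v_sum: "(\<Sum>k\<in>K. v k * h k) = (\<Sum>k\<in>K. b k * h k) / complex_of_real (sqrt s)" for h
    by (simp add: v_def sum_divide_distrib)
  have vF: "(\<Sum>k\<in>K. v k * f k) = 0" if "f \<in> F" for f
    using bG[of f] that by (simp add: v_sum G_def)
  have vc: "(\<Sum>k\<in>K. v k * cnj (c i k)) = 0" if "i < n" for i
    using bG[of "\<lambda>k. cnj (c i k)"] that by (simp add: v_sum G_def)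
  have cv: "(\<Sum>k\<in>K. c i k * cnj (v k)) = 0" if "i < n" for i
    using arg_cong[OF vc[OF that], of cnj] by (simp add: mult.commute)
  have vv: "(\<Sum>k\<in>K. v k * cnj (v k)) = 1"
  proof -
    have "(\<Sum>k\<in>K. v k * cnj (v k)) = (\<Sum>k\<in>K. complex_of_real ((cmod (b k))\<^sup>2 / s))"
    proof (rule sum.cong)
      fix k
      have "v k * cnj (v k) = (b k * cnj (b k)) / complex_of_real (sqrt s * sqrt s)"
        by (simp only: v_def complex_cnj_divide complex_cnj_complex_of_real times_divide_times_eq of_real_mult)
      then show "v k * cnj (v k) = complex_of_real ((cmod (b k))\<^sup>2 / s)"
        using s by (simp add: complex_norm_square del: of_real_power of_real_mult)
    qed simp
    also have "\<dots> = complex_of_real ((\<Sum>k\<in>K. (cmod (b k))\<^sup>2) / s)"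
      by (simp only: of_real_sum sum_divide_distrib)
    finally show ?thesis using s by (simp flip: s_def)
  qed
  show ?case
    using ker orth vF vc cv vv
    by (intro exI[of _ "c(n := v)"]) (auto simp: less_Suc_eq)
qed

text \<open>
  With \<open>b\<^sub>j = \<Sum>\<^sub>k c\<^sub>j\<^sub>k z\<^sub>k\<close>, the vector \<open>w = \<Sum>\<^sub>j b\<^sub>j (cnj c\<^sub>j)\<close> is the orthogonal projection of
  \<open>z\<close> to the span of the \<open>cnj c\<^sub>j\<close>, and the difference of the two sides is the squared norm of
  \<open>z - w\<close>. The pairing with \<open>z\<close> is bilinear because it is used to evaluate a linear combination
  of characters.
\<close>

lemma Bessel_inequality_finite:
  fixes c :: "'j \<Rightarrow> 'k \<Rightarrow> complex"
  assumes "finite J"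
    and orth: "\<And>i j. i \<in> J \<Longrightarrow> j \<in> J \<Longrightarrow>
      (\<Sum>k\<in>K. c i k * cnj (c j k)) = (if i = j then 1 else 0)"
  shows "(\<Sum>j\<in>J. (cmod (\<Sum>k\<in>K. c j k * z k))\<^sup>2) \<le> (\<Sum>k\<in>K. (cmod (z k))\<^sup>2)"
proof -
  define b where "b j = (\<Sum>k\<in>K. c j k * z k)" for j
  define w where "w k = (\<Sum>j\<in>J. b j * cnj (c j k))" for k
  have zw: "(\<Sum>k\<in>K. z k * cnj (w k)) = (\<Sum>j\<in>J. b j * cnj (b j))"
  proof -
    have "(\<Sum>k\<in>K. z k * cnj (w k)) = (\<Sum>k\<in>K. \<Sum>j\<in>J. cnj (b j) * (c j k * z k))"
      by (simp add: w_def sum_distrib_left mult_ac)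
    also have "\<dots> = (\<Sum>j\<in>J. cnj (b j) * b j)"
      by (subst sum.swap) (simp add: b_def sum_distrib_left)
    finally show ?thesis by (simp add: mult.commute)
  qed
  have wz: "(\<Sum>k\<in>K. w k * cnj (z k)) = (\<Sum>j\<in>J. b j * cnj (b j))"
    using arg_cong[OF zw, of cnj] by (simp add: mult.commute)
  have ww: "(\<Sum>k\<in>K. w k * cnj (w k)) = (\<Sum>j\<in>J. b j * cnj (b j))"
  proof -
    have "(\<Sum>k\<in>K. w k * cnj (w k)) =
        (\<Sum>k\<in>K. \<Sum>j\<in>J. \<Sum>i\<in>J. (b j * cnj (b i)) * (c i k * cnj (c j k)))"
      by (simp add: w_def sum_product mult_ac)
    also have "\<dots> = (\<Sum>j\<in>J. \<Sum>i\<in>J. (b j * cnj (b i)) * (\<Sum>k\<in>K. c i k * cnj (c j k)))"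
      by (subst sum.swap, rule sum.cong[OF refl], subst sum.swap) (simp add: sum_distrib_left)
    also have "\<dots> = (\<Sum>j\<in>J. \<Sum>i\<in>J. if i = j then b j * cnj (b i) else 0)"
      by (intro sum.cong refl) (simp add: orth)
    also have "\<dots> = (\<Sum>j\<in>J. b j * cnj (b j))"
      using \<open>finite J\<close> by (simp add: sum.delta)
    finally show ?thesis .
  qed
  have "complex_of_real (\<Sum>k\<in>K. (cmod (z k - w k))\<^sup>2) =
      (\<Sum>k\<in>K. z k * cnj (z k)) - (\<Sum>k\<in>K. z k * cnj (w k)) - (\<Sum>k\<in>K. w k * cnj (z k))
      + (\<Sum>k\<in>K. w k * cnj (w k))"
    by (simp add: complex_norm_square algebra_simps sum.distrib sum_subtractf del: of_real_power)
  also have "\<dots> = (\<Sum>k\<in>K. z k * cnj (z k)) - (\<Sum>j\<in>J. b j * cnj (b j))"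
    by (simp add: zw wz ww)
  also have "\<dots> = complex_of_real ((\<Sum>k\<in>K. (cmod (z k))\<^sup>2) - (\<Sum>j\<in>J. (cmod (b j))\<^sup>2))"
    by (simp add: complex_norm_square del: of_real_power)
  finally have "(\<Sum>k\<in>K. (cmod (z k))\<^sup>2) - (\<Sum>j\<in>J. (cmod (b j))\<^sup>2)
      = (\<Sum>k\<in>K. (cmod (z k - w k))\<^sup>2)"
    using of_real_eq_iff by metis
  also have "\<dots> \<ge> 0" by (simp add: sum_nonneg)
  finally show ?thesis by (simp add: b_def)
qed

section \<open>Characters of the torus\<close>

lemma norm_exp_ii_diff_le:
  "cmod (exp (\<i> * complex_of_real a) - exp (\<i> * complex_of_real b)) \<le> \<bar>a - b\<bar>"
proof -
  have "exp (\<i> * complex_of_real a) - exp (\<i> * complex_of_real b)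
      = exp (\<i> * complex_of_real b) * (exp (\<i> * complex_of_real (a - b)) - 1)"
    by (simp add: algebra_simps exp_diff)
  then have "cmod (exp (\<i> * complex_of_real a) - exp (\<i> * complex_of_real b))
      = 2 * \<bar>sin ((a - b) / 2)\<bar>"
    by (simp only: norm_mult dist_exp_i_1) simp
  also have "\<dots> \<le> \<bar>a - b\<bar>"
    using abs_sin_x_le_abs_x[of "(a - b) / 2"] by simp
  finally show ?thesis .
qed

text \<open>
  The phase \<open>2\<pi> k \<bullet> x\<close> is Lipschitz with constant \<open>2\<pi>|k|\<close> on Euclidean space; the quotient
  distance is an infimum over representatives, which is only approached up to a positive error.
\<close>

lemma torus_char_lipschitz:
  "cmod (torus_char k x - torus_char k y) \<le> 2 * pi * norm (ivec k) * dist x y"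
proof -
  obtain v w where v: "x = to_torus v" and w: "y = to_torus w" by (metis torus_cases)
  define L where "L = 2 * pi * norm (ivec k)"
  have L: "L \<ge> 0" by (simp add: L_def)
  have *: "cmod (torus_char k x - torus_char k y) \<le> L * norm (v - w + ivec l)" for l
  proof -
    have x: "x = to_torus (v + ivec l)"
      unfolding v to_torus_eq_iff by (auto intro!: exI[of _ "- l"] simp: ivec_minus)
    have "cmod (torus_char k x - torus_char k y) \<le> \<bar>2 * pi * (ivec k \<bullet> (v + ivec l)) - 2 * pi * (ivec k \<bullet> w)\<bar>"
      using norm_exp_ii_diff_le[of "2 * pi * (ivec k \<bullet> (v + ivec l))" "2 * pi * (ivec k \<bullet> w)"]
      by (simp add: x w torus_char.abs_eq mult_ac)
    also have "\<dots> = 2 * pi * \<bar>ivec k \<bullet> (v - w + ivec l)\<bar>"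
    proof -
      have "2 * pi * (ivec k \<bullet> (v + ivec l)) - 2 * pi * (ivec k \<bullet> w) = 2 * pi * (ivec k \<bullet> (v - w + ivec l))"
        by (simp add: inner_diff_right inner_add_right algebra_simps)
      then show ?thesis by (simp add: abs_mult)
    qed
    also have "\<dots> \<le> L * norm (v - w + ivec l)"
      using Cauchy_Schwarz_ineq2[of "ivec k" "v - w + ivec l"] by (simp add: L_def)
    finally show ?thesis .
  qed
  show ?thesis
    unfolding L_def[symmetric]
  proof (rule field_le_epsilon)
    fix e :: real assume e: "e > 0"
    define r where "r = e / (L + 1)"
    have r: "r > 0" "L * r \<le> e"
      using e L by (simp_all add: r_def field_simps)
    obtain l where l: "norm (v - w + ivec l) < dist x y + r"
      using torus_dist_less_iff[of v w "dist x y + r"] r by (auto simp: v w dist_torus_def)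
    have "cmod (torus_char k x - torus_char k y) \<le> L * (dist x y + r)"
      using *[of l] mult_left_mono[OF less_imp_le[OF l] L] by linarith
    also have "\<dots> \<le> L * dist x y + e" using r by (simp add: algebra_simps)
    finally show "cmod (torus_char k x - torus_char k y) \<le> L * dist x y + e" .
  qed
qed

lemma continuous_on_torus_char: "continuous_on S (torus_char k)"
  unfolding continuous_on_iff
proof (intro ballI allI impI)
  fix x and e :: real assume "x \<in> S" "e > 0"
  define L where "L = 2 * pi * norm (ivec k) + 1"
  have L: "L > 0" by (simp add: L_def add_nonneg_pos)
  have "dist (torus_char k y) (torus_char k x) < e" if "dist y x < e / L" for y
  proof -
    have "dist (torus_char k y) (torus_char k x) \<le> 2 * pi * norm (ivec k) * dist y x"
      using torus_char_lipschitz[of k y x] by (simp add: dist_norm)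
    also have "\<dots> \<le> L * dist y x" by (rule mult_right_mono) (simp_all add: L_def)
    also have "\<dots> < e" using that L by (simp add: field_simps)
    finally show ?thesis .
  qed
  then show "\<exists>d>0. \<forall>y\<in>S. dist y x < d \<longrightarrow> dist (torus_char k y) (torus_char k x) < e"
    using L \<open>e > 0\<close> by (intro exI[of _ "e / L"]) auto
qed

lemma torus_char_measurable [measurable]: "torus_char k \<in> borel_measurable borel"
  by (rule borel_measurable_continuous_onI) (rule continuous_on_torus_char)

lemma torus_char_mult_cnj: "torus_char k x * cnj (torus_char l x) = torus_char (k - l) x"
proof -
  obtain v where v: "x = to_torus v" by (metis torus_cases)
  show ?thesis
    unfolding v torus_char.abs_eq
    by (simp add: exp_cnj ivec_diff inner_diff_left algebra_simps flip: exp_add exp_diff)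
qed

lemma norm_torus_char [simp]: "cmod (torus_char k x) = 1"
proof -
  obtain v where v: "x = to_torus v" by (metis torus_cases)
  show ?thesis by (simp add: v torus_char.abs_eq norm_exp_eq_Re)
qed

section \<open>Parseval's identity\<close>

lemma integral_unit_interval_character:
  "(LINT t|lborel. indicator {0..<1} t *\<^sub>R exp (2 * complex_of_real pi * \<i> * complex_of_real (of_int m * t)))
     = (if m = 0 then 1 else 0)"
proof -
  define e where "e = (\<lambda>t. exp (2 * complex_of_real pi * \<i> * complex_of_real (of_int m * t)))"
  have "(LINT t|lborel. indicator {0..<1} t *\<^sub>R e t) = (LINT t|lborel. indicator {0..1} t *\<^sub>R e t)"
  proof (rule integral_cong_AE)
    show "AE t in lborel. indicator {0..<1} t *\<^sub>R e t = indicator {0..1} t *\<^sub>R e t"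
      using AE_lborel_singleton[of "1::real"] by eventually_elim (auto simp: indicator_def)
  qed (simp_all add: e_def)
  also have "\<dots> = (if m = 0 then 1 else 0)"
  proof (cases "m = 0")
    case True
    then show ?thesis by (simp add: e_def measure_def)
  next
    case False
    define z where "z = 2 * complex_of_real pi * \<i> * of_int m"
    have z: "z \<noteq> 0" using False by (simp add: z_def)
    have e: "e = (\<lambda>t. exp (z * complex_of_real t))" by (simp add: e_def z_def mult_ac)
    have "(LINT t|lborel. indicator {0..1} t *\<^sub>R e t) = exp (z * complex_of_real 1) / z - exp (z * complex_of_real 0) / z"
    proof (rule integral_FTC_atLeastAtMost)
      fix x :: real
      have "((\<lambda>u. exp (z * u) / z) has_field_derivative exp (z * complex_of_real x)) (at (complex_of_real x))"
        using z by (auto intro!: derivative_eq_intros)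
      then show "((\<lambda>t. exp (z * complex_of_real t) / z) has_vector_derivative e x) (at x within {0..1})"
        unfolding e by (rule has_vector_derivative_real_field)
    qed (auto simp: e intro!: continuous_intros)
    also have "exp (z * complex_of_real 1) = 1"
      using exp_integer_2pi[of "of_int m"] by (simp add: z_def mult_ac)
    finally show ?thesis using False by simp
  qed
  finally show ?thesis by (simp add: e_def)
qed


lemma prod_Basis_cart:
  "(\<Prod>b\<in>Basis. g b) = (\<Prod>i\<in>UNIV. g (axis i (1::real) :: real ^ 'n::finite))"
proof -
  have "(Basis :: (real ^ 'n) set) = range (\<lambda>i. axis i 1)"
    by (auto simp: Basis_vec_def)
  moreover have "inj (\<lambda>i. axis i (1::real) :: real ^ 'n)"
    by (auto simp: inj_def axis_eq_axis)
  ultimately show ?thesis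
    by (intro prod.reindex_cong[where l = "\<lambda>i. axis i 1"]) simp_all
qed

abbreviation unit_cell :: "(real ^ 'n::finite) set" where
  "unit_cell \<equiv> {x. \<forall>i. 0 \<le> x $ i \<and> x $ i < 1}"

lemma unit_cell_borel [measurable]: "unit_cell \<in> sets (borel :: (real ^ 'n::finite) measure)"
proof -
  have "{x :: real ^ 'n. 0 \<le> x $ i} \<inter> {x. x $ i < 1} \<in> sets borel" for i
    by (intro sets.Int borel_closed borel_open closed_halfspace_component_ge_cart open_halfspace_component_lt_cart)
  then have "(\<Inter>i. {x :: real ^ 'n. 0 \<le> x $ i} \<inter> {x. x $ i < 1}) \<in> sets borel"
    by (intro sets.countable_INT'' ) auto
  also have "(\<Inter>i. {x :: real ^ 'n. 0 \<le> x $ i} \<inter> {x. x $ i < 1}) = unit_cell"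
    by auto
  finally show ?thesis .
qed

lemma to_torus_measurable [measurable]: "to_torus \<in> borel_measurable borel"
  by (rule borel_measurable_continuous_onI) (rule continuous_on_to_torus)

lemma integral_torus_lebesgue:
  fixes f :: "'n::finite torus \<Rightarrow> 'b::{banach, second_countable_topology}"
  assumes [measurable]: "f \<in> borel_measurable borel"
  shows "integral\<^sup>L torus_lebesgue f = (LINT x|lborel. indicator unit_cell x *\<^sub>R f (to_torus x))"
proof -
  have "to_torus \<in> restrict_space lborel unit_cell \<rightarrow>\<^sub>M (borel :: 'n torus measure)"
    by (rule measurable_restrict_space1) simp
  then have "integral\<^sup>L torus_lebesgue f = (LINT x|restrict_space lborel unit_cell. f (to_torus x))"
    unfolding torus_lebesgue_def by (rule integral_distr) simp
  also have "\<dots> = (LINT x|lborel. indicator unit_cell x *\<^sub>R f (to_torus x))"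
    by (subst integral_restrict_space) simp_all
  finally show ?thesis .
qed

lemma finite_measure_torus_lebesgue: "finite_measure (torus_lebesgue :: 'n::finite torus measure)"
proof -
  have "emeasure lborel (unit_cell :: (real ^ 'n) set) \<le> emeasure lborel (cbox 0 (1 :: real ^ 'n))"
    by (rule emeasure_mono) (auto simp: mem_box_cart less_imp_le)
  also have "\<dots> < \<infinity>" by (rule emeasure_lborel_cbox_finite)
  finally have "emeasure lborel (unit_cell :: (real ^ 'n) set) \<noteq> \<infinity>" by simp
  then have "finite_measure (restrict_space lborel (unit_cell :: (real ^ 'n) set))"
    by (intro finite_measureI) (simp add: space_restrict_space emeasure_restrict_space)
  then show ?thesis
    unfolding torus_lebesgue_def
    by (rule finite_measure.finite_measure_distr) (rule measurable_restrict_space1, simp)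
qed

text \<open>
  On the unit cell a character is a product of one-dimensional characters, and Lebesgue measure is
  a product measure, so the integral factorises into integrals over \<open>{0..<1}\<close>.
\<close>

lemma integral_torus_char:
  "integral\<^sup>L torus_lebesgue (torus_char k) = (if k = 0 then 1 else 0)"
proof -
  define e where "e = (\<lambda>m t. indicator {0..<1::real} t *\<^sub>R
      exp (2 * complex_of_real pi * \<i> * complex_of_real (of_int m * t)))"
  define h :: "real ^ 'a \<Rightarrow> complex" where "h x = (\<Prod>i\<in>UNIV. e (k $ i) (x $ i))" for x
  have h: "indicator unit_cell x *\<^sub>R torus_char k (to_torus x) = h x" for x
  proof -
    have "torus_char k (to_torus x)
        = exp (\<Sum>i\<in>UNIV. 2 * complex_of_real pi * \<i> * complex_of_real (of_int (k $ i) * x $ i))"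
      by (simp add: torus_char.abs_eq inner_vec_def sum_distrib_left)
    also have "\<dots> = (\<Prod>i\<in>UNIV. exp (2 * complex_of_real pi * \<i> * complex_of_real (of_int (k $ i) * x $ i)))"
      by (simp add: exp_sum)
    finally have char: "torus_char k (to_torus x) = \<dots>" .
    show ?thesis
    proof (cases "x \<in> unit_cell")
      case True
      then show ?thesis by (simp add: char h_def e_def)
    next
      case False
      then obtain i where "x $ i \<notin> {0..<1}" by auto
      then have "e (k $ i) (x $ i) = 0" by (simp add: e_def)
      then have "h x = 0" unfolding h_def by (intro prod_zero) auto
      with False show ?thesis by simp
    qed
  qed
  have e_meas: "e m \<in> borel_measurable borel" for m
    unfolding e_def by measurable
  have e_int: "integrable lborel (e m)" for m
  proof (rule Bochner_Integration.integrable_bound)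
    show "integrable lborel (indicator {0..<1::real} :: real \<Rightarrow> real)" by simp
    show "AE t in lborel. norm (e m t) \<le> norm (indicator {0..<1} t :: real)"
      by (auto simp: e_def norm_exp_eq_Re)
  qed (use e_meas in simp)
  have e_integral: "integral\<^sup>L lborel (e m) = (if m = 0 then 1 else 0)" for m
    unfolding e_def by (rule integral_unit_interval_character)
  have h_meas: "h \<in> borel_measurable borel"
    unfolding h_def by (intro borel_measurable_prod measurable_compose[OF _ e_meas]) simp
  interpret product_sigma_finite "\<lambda>_ :: real ^ 'a. lborel :: real measure"
    by (simp add: product_sigma_finite_def sigma_finite_lborel)
  have "integral\<^sup>L torus_lebesgue (torus_char k) = (LINT x|lborel. h x)"
    by (simp add: integral_torus_lebesgue h)
  also have "\<dots> = (LINT f|Pi\<^sub>M Basis (\<lambda>_. lborel). h (\<Sum>b\<in>Basis. f b *\<^sub>R b))"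
    by (subst lborel_eq, subst integral_distr) (use h_meas in simp_all)
  also have "\<dots> = (LINT f|Pi\<^sub>M Basis (\<lambda>_. lborel). (\<Prod>b\<in>Basis. e (\<lfloor>ivec k \<bullet> b\<rfloor>) (f b)))"
  proof -
    have "h (\<Sum>b\<in>Basis. f b *\<^sub>R b) = (\<Prod>b\<in>Basis. e (\<lfloor>ivec k \<bullet> b\<rfloor>) (f b))" for f :: "real ^ 'a \<Rightarrow> real"
    proof -
      have "(\<Sum>b\<in>Basis. f b *\<^sub>R b) $ i = f (axis i 1)" for i
        using inner_sum_left_Basis[of "axis i 1" f] by (simp add: inner_axis)
      then show ?thesis by (simp add: h_def prod_Basis_cart inner_axis)
    qed
    then show ?thesis by simp
  qed
  also have "\<dots> = (\<Prod>b\<in>Basis. integral\<^sup>L lborel (e (\<lfloor>ivec k \<bullet> b\<rfloor>)))"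
    by (rule product_integral_prod) (simp_all add: e_int)
  also have "\<dots> = (\<Prod>i\<in>UNIV. if k $ i = 0 then 1 else 0)"
    by (simp add: prod_Basis_cart inner_axis e_integral)
  also have "\<dots> = (if k = 0 then 1 else 0)"
    by (auto simp: vec_eq_iff intro!: prod_zero)
  finally show ?thesis .
qed

lemma integrable_torus_char:
  assumes "finite_measure M" "sets M = sets borel"
  shows "integrable M (torus_char k)"
proof -
  interpret finite_measure M by fact
  have "torus_char k \<in> borel_measurable M"
    using torus_char_measurable measurable_cong_sets[OF assms(2) refl] by blast
  then show ?thesis by (intro integrable_const_bound[of _ 1]) simp_all
qed

lemma Parseval_torus:
  assumes "finite K"
  shows "(LINT x|torus_lebesgue. (cmod (\<Sum>k\<in>K. c k * torus_char k x))\<^sup>2) = (\<Sum>k\<in>K. (cmod (c k))\<^sup>2)"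
proof -
  have int: "integrable torus_lebesgue (torus_char k)" for k :: "int ^ 'a"
    by (intro integrable_torus_char finite_measure_torus_lebesgue) (simp add: torus_lebesgue_def)
  have "complex_of_real (LINT x|torus_lebesgue. (cmod (\<Sum>k\<in>K. c k * torus_char k x))\<^sup>2)
      = (LINT x|torus_lebesgue. (\<Sum>k\<in>K. \<Sum>l\<in>K. c k * cnj (c l) * torus_char (k - l) x))"
    unfolding integral_complex_of_real[symmetric]
  proof (rule Bochner_Integration.integral_cong[OF refl])
    fix x
    show "complex_of_real ((cmod (\<Sum>k\<in>K. c k * torus_char k x))\<^sup>2)
        = (\<Sum>k\<in>K. \<Sum>l\<in>K. c k * cnj (c l) * torus_char (k - l) x)"
      by (simp add: complex_norm_square sum_product mult_ac flip: torus_char_mult_cnj del: of_real_power)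
  qed
  also have "\<dots> = (\<Sum>k\<in>K. \<Sum>l\<in>K. c k * cnj (c l) * integral\<^sup>L torus_lebesgue (torus_char (k - l)))"
    by (simp add: int)
  also have "\<dots> = (\<Sum>k\<in>K. \<Sum>l\<in>K. if k = l then c k * cnj (c l) else 0)"
    by (intro sum.cong refl) (simp add: integral_torus_char)
  also have "\<dots> = complex_of_real (\<Sum>k\<in>K. (cmod (c k))\<^sup>2)"
    using assms by (simp add: sum.delta' complex_norm_square del: of_real_power)
  finally show ?thesis by (simp only: of_real_eq_iff)
qed

section \<open>The support carries the measure\<close>

text \<open>
  The complement of the support is a union of open null sets. Their preimages in Euclidean space
  have a countable subcover by Lindelof's theorem, and since \<open>to_torus\<close> is surjective the same
  countably many null sets cover the complement.
\<close>

lemma AE_measure_support_torus: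
  fixes M :: "'n::finite torus measure"
  assumes "sets M = sets borel"
  shows "AE x in M. x \<in> measure_support M"
proof -
  define \<U> where "\<U> = {U :: 'n torus set. open U \<and> emeasure M U = 0}"
  have "\<And>V. V \<in> (\<lambda>U. to_torus -` U) ` \<U> \<Longrightarrow> open V"
    by (auto simp: \<U>_def open_torus_def)
  then obtain \<V> where "\<V> \<subseteq> (\<lambda>U. to_torus -` U) ` \<U>" "countable \<V>"
    and V: "\<Union>\<V> = \<Union>((\<lambda>U. to_torus -` U) ` \<U>)"
    by (rule Lindelof)
  then obtain \<W> where W: "\<W> \<subseteq> \<U>" "countable \<W>" "\<V> = (\<lambda>U. to_torus -` U) ` \<W>"
    by (metis countable_subset_image)
  have "\<Union>\<U> = \<Union>\<W>"
  proof -
    have "x \<in> \<Union>\<W>" if "x \<in> \<Union>\<U>" for x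
    proof -
      obtain v where v: "x = to_torus v" by (metis torus_cases)
      with that have "v \<in> \<Union>\<V>" unfolding V by auto
      then show ?thesis unfolding W(3) v by auto
    qed
    with W(1) show ?thesis by blast
  qed
  moreover have "- measure_support M = \<Union>\<U>"
    by (auto simp: measure_support_def \<U>_def zero_less_iff_neq_zero)
  moreover have "\<Union>\<W> \<in> null_sets M"
  proof -
    have "U \<in> null_sets M" if "U \<in> \<W>" for U
      using that W(1) assms by (auto simp: null_sets_def \<U>_def)
    then show ?thesis using null_sets_UN'[OF W(2), of "\<lambda>U. U" M] by simp
  qed
  ultimately have "- measure_support M \<in> null_sets M" by simp
  then show ?thesis by (rule AE_I'[where N="- measure_support M"]) auto
qed


section \<open>Covering numbers and lattice points\<close>

text \<open>
  The quantitative core. If the covering has \<open>M\<close> centres and the sphere \<open>N \<ge> M\<close> points, there are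
  \<open>N - M\<close> orthonormal eigenfunctions that vanish at the centres, and by Bessel the sum of their
  squares is at most \<open>N (2\<pi>\<lambda>\<delta>)\<^sup>2\<close> on the support.
\<close>

lemma observability_sphere_card_le:
  fixes \<mu> :: "'n::finite torus measure" and m :: nat
  assumes "prob_space \<mu>" and sets: "sets \<mu> = sets borel"
    and "C \<ge> 0"
    and obs: "\<And>u. u \<in> laplace_eigenspace (sqrt m) \<Longrightarrow>
      (LINT x|torus_lebesgue. (cmod (u x))\<^sup>2) \<le> C * (LINT x|\<mu>. (cmod (u x))\<^sup>2)"
    and "\<delta> > 0" and small: "C * (2 * pi * sqrt m * \<delta>)\<^sup>2 \<le> 1/2"
  shows "card (lattice_sphere (sqrt m) :: (int ^ 'n) set) \<le> 2 * covering_number \<delta> (measure_support \<mu>)"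
proof -
  interpret prob_space \<mu> by fact
  define K :: "(int ^ 'n) set" where "K = lattice_sphere (sqrt m)"
  have K: "finite K" by (simp add: K_def finite_lattice_sphere)
  obtain A where A: "finite A" "card A = covering_number \<delta> (measure_support \<mu>)"
      "measure_support \<mu> \<subseteq> (\<Union>a\<in>A. cball a \<delta>)"
    using covering_number_attained[OF \<open>\<delta> > 0\<close>] by blast
  show ?thesis
  proof (cases "card A \<le> card K")
    case False
    then show ?thesis using A(2) by (simp add: K_def)
  next
    case True
    define n where "n = card K - card A"
    define F where "F = (\<lambda>a k. torus_char k a) ` A"
    have "n + card F \<le> card K"
      using card_image_le[OF A(1), of "\<lambda>a k. torus_char k a"] True by (simp add: n_def F_def)
    moreover have "finite F" using A(1) by (simp add: F_def)
    ultimately obtain c where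
      c: "\<forall>i<n. \<forall>f\<in>F. (\<Sum>k\<in>K. c i k * f k) = 0"
         "\<forall>i<n. \<forall>j<n. (\<Sum>k\<in>K. c i k * cnj (c j k)) = (if i = j then 1 else 0)"
      using orthonormal_system_in_kernel[OF K] by blast
    have ker: "(\<Sum>k\<in>K. c i k * torus_char k a) = 0" if "i < n" "a \<in> A" for i a
      using c(1) that by (auto simp: F_def)
    have orth: "(\<Sum>k\<in>K. c i k * cnj (c j k)) = (if i = j then 1 else 0)" if "i < n" "j < n" for i j
      using c(2) that by blast
    define u where "u i x = (\<Sum>k\<in>K. c i k * torus_char k x)" for i x
    define B where "B = real (card K) * (2 * pi * sqrt m * \<delta>)\<^sup>2"
    have u_mem: "u i \<in> laplace_eigenspace (sqrt m)" for i
      by (auto simp: laplace_eigenspace_def u_def K_def fun_eq_iff intro!: exI[of _ "c i"])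
    have u_norm: "(LINT x|torus_lebesgue. (cmod (u i x))\<^sup>2) = 1" if "i < n" for i
    proof -
      have "complex_of_real (\<Sum>k\<in>K. (cmod (c i k))\<^sup>2) = complex_of_real 1"
        using orth[OF that that] by (simp add: complex_norm_square del: of_real_power)
      then show ?thesis
        unfolding u_def Parseval_torus[OF K] by (simp only: of_real_eq_iff)
    qed
    have u_meas [measurable]: "u i \<in> borel_measurable \<mu>" for i
    proof -
      have "u i \<in> borel_measurable borel" unfolding u_def by measurable
      then show ?thesis using measurable_cong_sets[OF sets refl] by blast
    qed
    have small_on_support: "(\<Sum>i<n. (cmod (u i x))\<^sup>2) \<le> B" if x: "x \<in> measure_support \<mu>" for x
    proof -
      obtain a where a: "a \<in> A" "dist a x \<le> \<delta>" using A(3) x by (auto simp: subset_iff)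
      have "u i x = (\<Sum>k\<in>K. c i k * (torus_char k x - torus_char k a))" if "i < n" for i
        using ker[OF that a(1)] by (simp add: u_def right_diff_distrib sum_subtractf)
      then have "(\<Sum>i<n. (cmod (u i x))\<^sup>2)
          = (\<Sum>i<n. (cmod (\<Sum>k\<in>K. c i k * (torus_char k x - torus_char k a)))\<^sup>2)"
        by simp
      also have "\<dots> \<le> (\<Sum>k\<in>K. (cmod (torus_char k x - torus_char k a))\<^sup>2)"
        by (rule Bessel_inequality_finite) (simp_all add: orth)
      also have "\<dots> \<le> (\<Sum>k\<in>K. (2 * pi * sqrt m * \<delta>)\<^sup>2)"
      proof (intro sum_mono power_mono)
        fix k assume "k \<in> K"
        then have "cmod (torus_char k x - torus_char k a) \<le> 2 * pi * sqrt m * dist x a"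
          using torus_char_lipschitz[of k x a] by (simp add: K_def lattice_sphere_def)
        also have "\<dots> \<le> 2 * pi * sqrt m * \<delta>"
          using a(2) by (intro mult_left_mono) (simp_all add: dist_commute)
        finally show "cmod (torus_char k x - torus_char k a) \<le> 2 * pi * sqrt m * \<delta>" .
      qed simp
      finally show ?thesis by (simp add: B_def)
    qed
    have u_bound: "(cmod (u i x))\<^sup>2 \<le> (\<Sum>k\<in>K. cmod (c i k))\<^sup>2" for i x
      unfolding u_def by (intro power_mono sum_norm_le) (simp_all add: norm_mult)
    have u_int: "integrable \<mu> (\<lambda>x. (cmod (u i x))\<^sup>2)" for i
      by (rule integrable_const_bound[where B = "(\<Sum>k\<in>K. cmod (c i k))\<^sup>2"])
         (simp_all add: u_bound)
    have "real n = (\<Sum>i<n. (LINT x|torus_lebesgue. (cmod (u i x))\<^sup>2))"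
      by (simp add: u_norm)
    also have "\<dots> \<le> (\<Sum>i<n. C * (LINT x|\<mu>. (cmod (u i x))\<^sup>2))"
      by (intro sum_mono obs u_mem)
    also have "\<dots> = C * (LINT x|\<mu>. (\<Sum>i<n. (cmod (u i x))\<^sup>2))"
      by (simp add: u_int sum_distrib_left)
    also have "\<dots> \<le> C * (LINT x|\<mu>. B)"
    proof (intro mult_left_mono integral_mono_AE)
      show "AE x in \<mu>. (\<Sum>i<n. (cmod (u i x))\<^sup>2) \<le> B"
        using AE_measure_support_torus[OF sets] by eventually_elim (rule small_on_support)
    qed (simp_all add: u_int \<open>C \<ge> 0\<close>)
    also have "\<dots> = card K * (C * (2 * pi * sqrt m * \<delta>)\<^sup>2)"
      by (simp add: B_def prob_space)
    also have "\<dots> \<le> card K * (1/2)"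
      by (rule mult_left_mono[OF small]) simp
    finally have "2 * real n \<le> real (card K)" by simp
    then have "card K \<le> 2 * card A" using True by (simp add: n_def of_nat_diff)
    then show ?thesis by (simp add: K_def A(2))
  qed
qed

text \<open>
  Pigeonhole principle for \<open>k \<mapsto> |k|\<^sup>2\<close> on the cube \<open>{1..R}\<^sup>n\<close>. Individual spheres may carry far
  fewer points (in dimension \<open>4\<close>, those with \<open>|k|\<^sup>2\<close> a power of \<open>2\<close> have at most \<open>24\<close>), so that a
  choice of radius is necessary.
\<close>

lemma exists_rich_lattice_sphere:
  assumes "R > 0"
  shows "\<exists>m\<in>{1..CARD('n::finite) * R\<^sup>2}.
    R ^ CARD('n) \<le> card (lattice_sphere (sqrt (real m)) :: (int ^ 'n) set) * (CARD('n) * R\<^sup>2)"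
proof -
  define Q :: "(int ^ 'n) set" where "Q = vec_lambda ` (UNIV \<rightarrow>\<^sub>E {1..int R})"
  define q :: "int ^ 'n \<Rightarrow> nat" where "q k = nat (\<Sum>i\<in>UNIV. (k $ i)\<^sup>2)" for k
  have "finite (UNIV \<rightarrow>\<^sub>E {1..int R} :: ('n \<Rightarrow> int) set)"
    by (rule finite_PiE) simp_all
  then have finQ: "finite Q" unfolding Q_def by (rule finite_imageI)
  have cardQ: "card Q = R ^ CARD('n)"
    unfolding Q_def by (subst card_image) (auto simp: inj_on_def card_PiE vec_lambda_inject)
  have "q \<in> Q \<rightarrow> {1..CARD('n) * R\<^sup>2}"
  proof
    fix k assume "k \<in> Q"
    then have k: "1 \<le> k $ i" "k $ i \<le> int R" for i by (auto simp: Q_def)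
    have "(\<Sum>i\<in>UNIV. (k $ i)\<^sup>2) \<le> (\<Sum>i\<in>(UNIV :: 'n set). (int R)\<^sup>2)"
      using k by (intro sum_mono power_mono) (auto intro: order_trans[OF zero_le_one])
    moreover have "1 \<le> (\<Sum>i\<in>UNIV. (k $ i)\<^sup>2)"
    proof -
      have "1 \<le> int CARD('n)" by (simp add: Suc_leI)
      also have "\<dots> = (\<Sum>i\<in>(UNIV :: 'n set). 1)" by simp
      also have "\<dots> \<le> (\<Sum>i\<in>UNIV. (k $ i)\<^sup>2)"
        using k by (intro sum_mono one_le_power)
      finally show ?thesis .
    qed
    ultimately show "q k \<in> {1..CARD('n) * R\<^sup>2}"
      by (auto simp: q_def nat_le_iff le_nat_iff)
  qed
  moreover have "{1..CARD('n) * R\<^sup>2} \<noteq> {}" using assms by (simp add: Suc_leI)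
  ultimately obtain m where m: "m \<in> {1..CARD('n) * R\<^sup>2}"
      "card Q \<le> card (q -` {m} \<inter> Q) * card {1..CARD('n) * R\<^sup>2}"
    using pigeonhole_card[OF _ finQ finite_atLeastAtMost] by blast
  have "q -` {m} \<inter> Q \<subseteq> lattice_sphere (sqrt (real m))"
  proof
    fix k assume k: "k \<in> q -` {m} \<inter> Q"
    have "real (q k) = (\<Sum>i\<in>UNIV. (real_of_int (k $ i))\<^sup>2)"
      by (simp add: q_def sum_nonneg)
    then show "k \<in> lattice_sphere (sqrt (real m))"
      using k by (simp add: lattice_sphere_def norm_vec_def L2_set_def)
  qed
  then have "card (q -` {m} \<inter> Q) \<le> card (lattice_sphere (sqrt (real m)) :: (int ^ 'n) set)"
    by (intro card_mono finite_lattice_sphere)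
  with m cardQ show ?thesis
    by (intro bexI[of _ m]) (auto intro: order_trans mult_right_mono)
qed

lemma covering_number_le_powr:
  assumes "upper_minkowski_dim E < ereal t"
  shows "\<exists>s<t. \<forall>\<^sub>F \<delta> in at_right 0. real (covering_number \<delta> E) \<le> \<delta> powr (- s)"
proof -
  obtain s where s: "upper_minkowski_dim E < ereal s" "s < t"
    using ereal_dense2[OF assms] by auto
  have "\<forall>\<^sub>F \<delta> in at_right 0. ereal (ln (real (covering_number \<delta> E)) / (- ln \<delta>)) < ereal s"
    using s(1) unfolding upper_minkowski_dim_def by (rule Limsup_lessD)
  moreover have "\<forall>\<^sub>F \<delta> :: real in at_right 0. 0 < \<delta> \<and> \<delta> < 1"
    by (rule eventually_at_rightI[of 0 1]) auto
  ultimately have "\<forall>\<^sub>F \<delta> in at_right 0. real (covering_number \<delta> E) \<le> \<delta> powr (- s)"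
  proof eventually_elim
    case (elim \<delta>)
    show ?case
    proof (cases "covering_number \<delta> E = 0")
      case False
      have "ln (real (covering_number \<delta> E)) \<le> - s * ln \<delta>"
        using elim by (simp add: divide_simps split: if_splits)
      then show ?thesis
        using False elim by (simp add: powr_def ln_ge_iff flip: ln_le_cancel_iff)
    qed simp
  qed
  with s(2) show ?thesis by blast
qed

theorem theorem1p2:
  fixes \<mu> :: "'d::finite torus measure"
  assumes "CARD('d) \<ge> 2"
    and "prob_space \<mu>"
    and "sets \<mu> = sets borel"
    and "observability \<mu>"
  shows "upper_minkowski_dim (measure_support \<mu>) \<ge> ereal (real CARD('d) - 2)"
proof (rule ccontr)
  define E where "E = measure_support \<mu>"
  define d where "d = CARD('d)"
  assume "\<not> ?thesis"
  then obtain s where s: "s < real d - 2"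
    and cov: "\<forall>\<^sub>F \<delta> in at_right 0. real (covering_number \<delta> E) \<le> \<delta> powr (- s)"
    using covering_number_le_powr[of E "real d - 2"] by (auto simp: E_def d_def not_le)
  obtain C0 where C0: "\<And>u m. u \<in> laplace_eigenspace (sqrt (real m)) \<Longrightarrow>
      (LINT x|torus_lebesgue. (cmod (u x))\<^sup>2) \<le> C0 * (LINT x|\<mu>. (cmod (u x))\<^sup>2)"
    using assms(4) unfolding observability_def by blast
  \<comment> \<open>The integral against \<open>\<mu>\<close> is nonnegative, so the constant may be enlarged to be positive.\<close>
  define C where "C = max C0 1"
  have C: "C \<ge> 1" by (simp add: C_def)
  have obs: "(LINT x|torus_lebesgue. (cmod (u x))\<^sup>2) \<le> C * (LINT x|\<mu>. (cmod (u x))\<^sup>2)"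
    if "u \<in> laplace_eigenspace (sqrt (real m))" for u m
  proof -
    have "C0 * (LINT x|\<mu>. (cmod (u x))\<^sup>2) \<le> C * (LINT x|\<mu>. (cmod (u x))\<^sup>2)"
      by (rule mult_right_mono) (simp_all add: C_def)
    with C0[OF that] show ?thesis by linarith
  qed
  \<comment> \<open>For \<open>m \<le> d R\<^sup>2\<close> and \<open>\<delta> = \<epsilon> / R\<close> this makes \<open>C (2\<pi> \<surd>m \<delta>)\<^sup>2\<close> at most \<open>1/2\<close>.\<close>
  define \<epsilon> where "\<epsilon> = 1 / (2 * pi * sqrt (2 * C * d))"
  have d: "d > 0" by (simp add: d_def)
  have \<epsilon>: "\<epsilon> > 0" using C d by (simp add: \<epsilon>_def)
  have bound: "real R ^ d \<le> 2 * covering_number (\<epsilon> / R) E * (d * real R ^ 2)" if R: "R > 0" for R :: nat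
  proof -
    obtain m where m: "m \<le> d * R\<^sup>2"
      "R ^ d \<le> card (lattice_sphere (sqrt (real m)) :: (int ^ 'd) set) * (d * R\<^sup>2)"
      using exists_rich_lattice_sphere[where 'n='d, OF R] by (auto simp: d_def)
    have "card (lattice_sphere (sqrt (real m)) :: (int ^ 'd) set) \<le> 2 * covering_number (\<epsilon> / R) E"
      unfolding E_def
    proof (rule observability_sphere_card_le[OF assms(2,3), where C = C])
      have "C * (2 * pi * sqrt m * (\<epsilon> / R))\<^sup>2 = real m / (2 * d * real R ^ 2)"
        using C d R by (simp add: \<epsilon>_def power_mult_distrib power_divide field_simps)
      also have "\<dots> \<le> 1/2"
        using m(1) d R by (simp add: field_simps flip: of_nat_power of_nat_mult)
      finally show "C * (2 * pi * sqrt m * (\<epsilon> / R))\<^sup>2 \<le> 1/2" .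
    qed (use obs C \<epsilon> R in auto)
    then have "R ^ d \<le> 2 * covering_number (\<epsilon> / R) E * (d * R\<^sup>2)"
      using m(2) order_trans mult_right_mono by blast
    then have "real (R ^ d) \<le> real (2 * covering_number (\<epsilon> / R) E * (d * R\<^sup>2))"
      by (rule of_nat_mono)
    then show ?thesis by simp
  qed
  have "filterlim (\<lambda>R::nat. \<epsilon> / real R) (at_right 0) sequentially"
    using \<epsilon> by real_asymp
  from eventually_compose_filterlim[OF cov this]
  have "\<forall>\<^sub>F R in sequentially. real (covering_number (\<epsilon> / real R) E) \<le> (\<epsilon> / real R) powr (- s)" .
  moreover have "\<forall>\<^sub>F R::nat in sequentially. 2 * (\<epsilon> / real R) powr (- s) * (d * real R ^ 2) < real R powr d"
    using \<epsilon> d s by real_asymp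
  moreover have "\<forall>\<^sub>F R::nat in sequentially. R > 0"
    by (rule eventually_gt_at_top)
  ultimately have "\<forall>\<^sub>F R::nat in sequentially. False"
  proof eventually_elim
    case (elim R)
    have "real R powr d \<le> 2 * covering_number (\<epsilon> / R) E * (d * real R ^ 2)"
      using bound[OF elim(3)] elim(3) by (simp add: powr_realpow)
    also have "\<dots> \<le> 2 * (\<epsilon> / real R) powr (- s) * (d * real R ^ 2)"
      using elim(1) by (intro mult_right_mono mult_left_mono) simp_all
    finally show False using elim(2) by simp
  qed
  then show False by simp
qed

end
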